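(* Let $\beta,\kappa\in\mathbb{R}$ be nonzero and let $\delta_1,\delta_2\in\mathbb{R}$ be arbitrary. Then the function $$u(x,t)=-\frac{3\sqrt{1+\kappa^2}}{\kappa\beta}\tanh\!\left[\tfrac12\sqrt{1+\kappa^2}\,(x+\kappa t+\delta_1)\right]+\frac{3\sqrt{1+\kappa^2}}{\kappa\beta}\tanh\!\left[\tfrac12\sqrt{1+\kappa^2}\,(x-\kappa t+\delta_2)\right]$$ is an exact solution, for all $(x,t)\in\mathbb{R}^2$, of the partial differential equation $$u_{tt}+u_{xx}+\beta\,(u_xu_{xt}+u_tu_{xx})-u_{xxxx}=0 .$$
   Context: Subscripts denote partial derivatives. *)

theory Defs
  imports "HOL-Analysis.Analysis"
begin

definition partial_x :: "(real \<Rightarrow> real \<Rightarrow> real) \<Rightarrow> real \<Rightarrow> real \<Rightarrow> real" where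
  "partial_x u = (\<lambda>x t. deriv (\<lambda>y. u y t) x)"

definition partial_t :: "(real \<Rightarrow> real \<Rightarrow> real) \<Rightarrow> real \<Rightarrow> real \<Rightarrow> real" where
  "partial_t u = (\<lambda>x t. deriv (\<lambda>s. u x s) t)"

(* deriv is total, so existence of the partial derivatives is stated separately. *)

definition has_partial_x :: "(real \<Rightarrow> real \<Rightarrow> real) \<Rightarrow> bool" where
  "has_partial_x u \<longleftrightarrow> (\<forall>x t. (\<lambda>y. u y t) field_differentiable at x)"

definition has_partial_t :: "(real \<Rightarrow> real \<Rightarrow> real) \<Rightarrow> bool" where
  "has_partial_t u \<longleftrightarrow> (\<forall>x t. (\<lambda>s. u x s) field_differentiable at t)"

(* Subscripts are read from left to right: u_xt is the t-derivative of u_x. *)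

definition exact_solution :: "real \<Rightarrow> (real \<Rightarrow> real \<Rightarrow> real) \<Rightarrow> bool" where
  "exact_solution \<beta> u \<longleftrightarrow>
    (let u_x = partial_x u; u_t = partial_t u;
         u_xx = partial_x u_x; u_xt = partial_t u_x; u_tt = partial_t u_t;
         u_xxx = partial_x u_xx; u_xxxx = partial_x u_xxx
     in has_partial_x u \<and> has_partial_t u \<and>
        has_partial_x u_x \<and> has_partial_t u_x \<and> has_partial_t u_t \<and>
        has_partial_x u_xx \<and> has_partial_x u_xxx \<and>
        (\<forall>x t. u_tt x t + u_xx x t + \<beta> * (u_x x t * u_xt x t + u_t x t * u_xx x t)
                 - u_xxxx x t = 0))"

end

(* For a superposition u = f(x + k t + d1) + g(x - k t + d2) the cross terms in u_x u_xt + u_t u_xx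
   cancel, so the equation decouples into (1 + k^2) f_2 + 2 b k f_1 f_2 = f_4 (with f_i the i-th derivative) and the same equation
   with -k for g. The ansatz A tanh(c y) solves such an equation when 4 c^2 = 1 + k^2 and
   b k A = -6 c. *)
theory Submission
  imports Defs
begin

lemma partial_x_eqI:
  assumes "\<And>x t. ((\<lambda>y. u y t) has_real_derivative v x t) (at x)"
  shows "partial_x u = v" "has_partial_x u"
  using assms unfolding partial_x_def has_partial_x_def field_differentiable_def
  by (blast intro: ext DERIV_imp_deriv)+

lemma partial_t_eqI:
  assumes "\<And>x t. ((\<lambda>s. u x s) has_real_derivative v x t) (at t)"
  shows "partial_t u = v" "has_partial_t u"
  using assms unfolding partial_t_def has_partial_t_def field_differentiable_def
  by (blast intro: ext DERIV_imp_deriv)+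

text \<open>Here \<open>f i\<close> and \<open>g i\<close> stand for the i-th derivatives of the two
  profiles. The bracket after \<beta> is \<kappa> ((f1 + g1)(f2 - g2) + (f1 - g1)(f2 + g2)) = 2
  \<kappa> (f1 f2 - g1 g2), so each profile only meets its own equation.\<close>

lemma exact_solution_travelling_waves:
  fixes f g :: "nat \<Rightarrow> real \<Rightarrow> real"
  assumes f: "\<And>i y. i < 4 \<Longrightarrow> (f i has_real_derivative f (Suc i) y) (at y)"
    and g: "\<And>i y. i < 4 \<Longrightarrow> (g i has_real_derivative g (Suc i) y) (at y)"
    and f_ode: "\<And>y. (1 + \<kappa>\<^sup>2) * f 2 y + 2 * \<beta> * \<kappa> * f 1 y * f 2 y = f 4 y"
    and g_ode: "\<And>y. (1 + \<kappa>\<^sup>2) * g 2 y - 2 * \<beta> * \<kappa> * g 1 y * g 2 y = g 4 y"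
  shows "exact_solution \<beta> (\<lambda>x t. f 0 (x + \<kappa> * t + a) + g 0 (x - \<kappa> * t + b))"
proof -
  \<comment> \<open>This family is closed under differentiation: both partials raise
    \<open>i\<close>, and the t-partial also multiplies \<open>p\<close> by \<kappa> and
    \<open>q\<close> by -\<kappa>. Every partial of \<open>w 1 1 0\<close> in the equation is thus
    some \<open>w p q i\<close>.\<close>
  define w where "w p q i = (\<lambda>x t. p * f i (x + \<kappa> * t + a) + q * g i (x - \<kappa> * t + b))"
    for p q i
  have dx: "((\<lambda>y. w p q i y t) has_real_derivative w p q (Suc i) x t) (at x)"
    if "i < 4" for p q i x t
    unfolding w_def
    by (auto intro!: derivative_eq_intros DERIV_chain2[OF f[OF that]] DERIV_chain2[OF g[OF that]])
  have dt: "((\<lambda>s. w p q i x s) has_real_derivative w (\<kappa> * p) (- \<kappa> * q) (Suc i) x t) (at t)"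
    if "i < 4" for p q i x t
    unfolding w_def
    by (auto intro!: derivative_eq_intros DERIV_chain2[OF f[OF that]] DERIV_chain2[OF g[OF that]])
  note X = partial_x_eqI[OF dx] and T = partial_t_eqI[OF dt]
  have "w 1 1 2 x t * \<kappa>\<^sup>2 + w 1 1 2 x t
      + \<beta> * (w 1 1 1 x t * w \<kappa> (- \<kappa>) 2 x t + w \<kappa> (- \<kappa>) 1 x t * w 1 1 2 x t)
      - w 1 1 4 x t = 0" for x t
    unfolding w_def f_ode[symmetric] g_ode[symmetric] by (simp add: algebra_simps)
  \<comment> \<open>Both wave speeds square to the same value, so u_tt = \<kappa>^2 u_xx.\<close>
  moreover have "w (\<kappa> * \<kappa>) (\<kappa> * \<kappa>) 2 x t = w 1 1 2 x t * \<kappa>\<^sup>2" for x t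
    by (simp add: w_def power2_eq_square algebra_simps)
  ultimately have "exact_solution \<beta> (w 1 1 0)"
    by (simp add: exact_solution_def Let_def X T numeral_eq_Suc)
  then show ?thesis by (simp add: w_def)
qed

text \<open>The list holds the derivatives of tanh as polynomials in T, obtained by iterating T' = 1
  - T^2; the chain rule contributes \<open>c ^ i\<close>. Only indices up to 4 are
  meaningful.\<close>

definition kink :: "real \<Rightarrow> real \<Rightarrow> nat \<Rightarrow> real \<Rightarrow> real" where
  "kink A c i y = (let T = tanh (c * y) in
     A * c ^ i * [T, 1 - T\<^sup>2, 2 * T ^ 3 - 2 * T, (6 * T\<^sup>2 - 2) * (1 - T\<^sup>2),
                  (16 * T - 24 * T ^ 3) * (1 - T\<^sup>2)] ! i)"

lemma kink_has_derivative:
  assumes "i < 4"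
  shows "(kink A c i has_real_derivative kink A c (Suc i) y) (at y)"
proof -
  have [derivative_intros]:
    "((\<lambda>y. tanh (c * y)) has_real_derivative c * (1 - (tanh (c * y))\<^sup>2)) (at y)"
    by (auto intro!: derivative_eq_intros simp: less_imp_neq[OF cosh_real_pos, symmetric])
  have "i \<in> {0, 1, 2, 3}" using assms by auto
  then show ?thesis
    unfolding kink_def[abs_def] Let_def
    by (elim insertE emptyE)
      (auto intro!: derivative_eq_intros simp: numeral_eq_Suc algebra_simps)
qed

text \<open>Since 2 T^3 - 2 T = -2 T (1 - T^2), the left side is A c^4 (1 - T^2) (-2 T) (4 - 12 (1 -
  T^2)), and the last two factors multiply to 16 T - 24 T^3.\<close>

lemma kink_ode:
  assumes "4 * c\<^sup>2 = 1 + \<kappa>\<^sup>2" and "\<beta> * \<kappa> * A = - 6 * c"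
  shows "(1 + \<kappa>\<^sup>2) * kink A c 2 y + 2 * \<beta> * \<kappa> * kink A c 1 y * kink A c 2 y = kink A c 4 y"
proof -
  define T where "T = tanh (c * y)"
  have k: "kink A c 1 y = A * c * (1 - T\<^sup>2)" "kink A c 2 y = A * c\<^sup>2 * (2 * T ^ 3 - 2 * T)"
    "kink A c 4 y = A * c ^ 4 * ((16 * T - 24 * T ^ 3) * (1 - T\<^sup>2))"
    by (simp_all add: kink_def T_def Let_def eval_nat_numeral)
  have f1: "2 * \<beta> * \<kappa> * kink A c 1 y = - 12 * c\<^sup>2 * (1 - T\<^sup>2)"
    using assms(2) unfolding k by algebra
  show ?thesis
    unfolding f1 assms(1)[symmetric] unfolding k by (simp add: algebra_simps eval_nat_numeral)
qed

theorem mainTheorem2: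
  fixes \<beta> \<kappa> \<delta>\<^sub>1 \<delta>\<^sub>2 :: real
  assumes "\<beta> \<noteq> 0" and "\<kappa> \<noteq> 0"
  shows "exact_solution \<beta> (\<lambda>x t.
      - (3 * sqrt (1 + \<kappa>\<^sup>2) / (\<kappa> * \<beta>))
          * tanh (1 / 2 * sqrt (1 + \<kappa>\<^sup>2) * (x + \<kappa> * t + \<delta>\<^sub>1))
      + 3 * sqrt (1 + \<kappa>\<^sup>2) / (\<kappa> * \<beta>)
          * tanh (1 / 2 * sqrt (1 + \<kappa>\<^sup>2) * (x - \<kappa> * t + \<delta>\<^sub>2)))"
proof -
  define c where "c = sqrt (1 + \<kappa>\<^sup>2) / 2"
  define A where "A = 6 * c / (\<kappa> * \<beta>)"
  have c: "4 * c\<^sup>2 = 1 + \<kappa>\<^sup>2"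
    by (simp add: c_def power_divide add_nonneg_nonneg)
  have A: "\<beta> * \<kappa> * A = 6 * c"
    using assms by (simp add: A_def)
  \<comment> \<open>The condition on the amplitude changes sign with the speed, hence -A for the
    wave with \<kappa> and A for the wave with -\<kappa>.\<close>
  have "exact_solution \<beta>
      (\<lambda>x t. kink (- A) c 0 (x + \<kappa> * t + \<delta>\<^sub>1) + kink A c 0 (x - \<kappa> * t + \<delta>\<^sub>2))"
    using kink_ode[of c \<kappa> \<beta> "- A"] kink_ode[of c "- \<kappa>" \<beta> A] c A
    by (intro exact_solution_travelling_waves kink_has_derivative) auto
  then show ?thesis
    by (simp add: kink_def Let_def A_def c_def)
qed

end
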